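(* For every integer $n\geq 2$, $$L_{n+1}(q)=3L_n(q)+2(q-1)L_{n-1}(q).$$
   Context: Define polynomials $b_n(q)$, $n\geq 1$, by $b_1(q)=1$ and, for $n\geq 1$ (and for the second and third relations also $n\geq 0$ whenever the indices involved are $\geq 1$), $b_{2n}(q)=b_n(q)$, $b_{4n+1}(q)=q\,b_{2n}(q)+b_{2n+1}(q)$, $b_{4n+3}(q)=b_{2n+1}(q)+q\,b_{2n+2}(q)$. For $n\geq 1$ let $L_n(q)=2\left(\sum_{k=1}^{2^n-1}b_k(q)\right)+b_{2^n}(q)$. *)

theory Defs
  imports "HOL-Computational_Algebra.Polynomial"
begin

abbreviation q :: "int poly" where
  "q \<equiv> [:0, 1:]"

text \<open>The sequence is indexed from 1; the value at index 0 is a dummy that no other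
  equation refers to.\<close>

function b :: "nat \<Rightarrow> int poly" where
  "b 0 = 0"
| "b (Suc 0) = 1"
| "n \<ge> 1 \<Longrightarrow> b (2 * n) = b n"
| "n \<ge> 1 \<Longrightarrow> b (4 * n + 1) = q * b (2 * n) + b (2 * n + 1)"
| "b (4 * n + 3) = b (2 * n + 1) + q * b (2 * n + 2)"
  by (atomize_elim, presburger) (rule refl | (rule FalseE, presburger) | simp)+
termination
  by (relation "measure id") auto

definition L :: "nat \<Rightarrow> int poly" where
  "L n = 2 * (\<Sum>k = 1..2 ^ n - 1. b k) + b (2 ^ n)"

end

theory Submission
  imports Defs
begin

text \<open>With \<open>b 0 = 0\<close> one has \<open>L n = T (2 ^ n)\<close> for the trapezoidal sum
  \<open>T N = (\<Sum>k<N. b k + b (k + 1))\<close>. Splitting by parity gives \<open>T (2 * N) = T N + 2 * U N\<close>, where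
  \<open>U N = (\<Sum>k<N. b (2 * k + 1))\<close>, and adding the two odd-index recurrences gives
  \<open>U (2 * N) = q * T N + 2 * U N\<close>. Eliminating \<open>U\<close> yields the three-term recurrence.\<close>

lemma b_double: "b (2 * n) = b n"
  using b.simps(3)[of n] by (cases "n = 0") simp_all

text \<open>The case \<open>n = 0\<close> holds because of the value chosen for \<open>b 0\<close>.\<close>
lemma b_odd_pair:
  "b (4 * n + 1) + b (4 * n + 3) = q * (b n + b (n + 1)) + 2 * b (2 * n + 1)"
proof -
  have step: "b (4 * n + 1) = q * b n + b (2 * n + 1)"
  proof (cases "n = 0")
    case False
    then show ?thesis
      using b.simps(4)[of n] b_double[of n] by simp
  qed simp
  have "b (2 * n + 2) = b (n + 1)"
    using b_double[of "n + 1"] by simp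
  \<comment> \<open>The product rules for \<open>pCons\<close> are switched off so that
    \<open>q\<close> stays an unexpanded factor.\<close>
  then show ?thesis
    using step b.simps(5)[of n] by (simp add: algebra_simps del: mult_pCons_left mult_pCons_right)
qed

definition T :: "nat \<Rightarrow> int poly" where
  "T N = (\<Sum>k<N. b k + b (k + 1))"

definition U :: "nat \<Rightarrow> int poly" where
  "U N = (\<Sum>k<N. b (2 * k + 1))"

lemma T_double: "T (2 * N) = T N + 2 * U N"
proof (induction N)
  case (Suc N)
  have "T (2 * Suc N) = T (2 * N) + (b (2 * N) + 2 * b (2 * N + 1) + b (2 * (N + 1)))"
    by (simp add: T_def)
  also have "\<dots> = T N + 2 * U N + (b N + 2 * b (2 * N + 1) + b (N + 1))"
    by (simp only: Suc.IH b_double)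
  finally show ?case
    by (simp add: T_def U_def algebra_simps)
qed (simp add: T_def U_def)

lemma U_double: "U (2 * N) = q * T N + 2 * U N"
proof (induction N)
  case (Suc N)
  have "U (2 * Suc N) = U (2 * N) + (b (4 * N + 1) + b (4 * N + 3))"
    by (simp add: U_def numeral_3_eq_3)
  also have "\<dots> = q * T N + 2 * U N + (q * (b N + b (N + 1)) + 2 * b (2 * N + 1))"
    by (simp only: Suc.IH b_odd_pair)
  also have "\<dots> = q * (T N + (b N + b (N + 1))) + 2 * (U N + b (2 * N + 1))"
    by (simp only: distrib_left add_ac)
  finally show ?case
    by (simp only: T_def U_def sum.lessThan_Suc)
qed (simp add: T_def U_def)

text \<open>Each interior index lies in two consecutive summands of \<open>T\<close>; the lower
  endpoint contributes \<open>b 0 = 0\<close>.\<close>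

lemma T_eq: "T (Suc N) = 2 * (\<Sum>k = 1..N. b k) + b (Suc N)"
  by (induction N) (simp_all add: T_def algebra_simps)

lemma L_eq_T: "L n = T (2 ^ n)"
  using T_eq[of "2 ^ n - 1"] by (simp add: L_def)

lemma L_rec: "L (n + 2) = 3 * L (n + 1) + 2 * (q - 1) * L n"
proof -
  have 1: "L (n + 1) = L n + 2 * U (2 ^ n)"
    using T_double[of "2 ^ n"] by (simp add: L_eq_T)
  have 2: "L (n + 2) = L (n + 1) + 2 * (q * L n + 2 * U (2 ^ n))"
    using T_double[of "2 * 2 ^ n"] unfolding U_double by (simp add: L_eq_T)
  \<comment> \<open>By \<open>1\<close>, \<open>4 * U (2 ^ n)\<close> equals
    \<open>2 * (L (n + 1) - L n)\<close>; substituting this into \<open>2\<close> eliminates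
    \<open>U\<close>.\<close>
  show ?thesis
    using 1 2 by algebra
qed

theorem theorem2p1:
  fixes n :: nat
  assumes "n \<ge> 2"
  shows "L (n + 1) = 3 * L n + 2 * (q - 1) * L (n - 1)"
  using L_rec[of "n - 1"] assms by simp

end
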